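(* Let $\alpha=(\alpha_n)_{n\in\mathbb{N}}$ and $\beta=(\beta_n)_{n\in\mathbb{N}}$ be exponent sequences such that the power series space of infinite type $\Lambda_\infty(\alpha)$ and the power series space of finite type $\Lambda_1(\beta)$ are both nuclear. Let $\theta=(\theta_j)_{j\in\mathbb{Z}}$ be a two-sided scalar sequence. If $\theta\in\Lambda_1(\beta)\oplus(\Lambda_\infty(\alpha))'$, then the Toeplitz operator $T_\theta:\Lambda_\infty(\alpha)\to\Lambda_1(\beta)$ is well-defined, continuous and compact.
   Context: $\mathbb{N}=\{1,2,3,\dots\}$. An exponent sequence is a non-negative increasing sequence $\alpha=(\alpha_n)_{n\in\mathbb{N}}$ with $\lim_n\alpha_n=\infty$. The power series spaces are $\Lambda_\infty(\alpha)=\{x=(x_n)_{n\in\mathbb{N}}: \|x\|_k:=\sum_n|x_n|e^{k\alpha_n}<\infty\ \forall k\in\mathbb{N}\}$ and $\Lambda_1(\beta)=\{x=(x_n)_{n\in\mathbb{N}}: \|x\|_k:=\sum_n|x_n|e^{-\frac1k\beta_n}<\infty\ \forall k\in\mathbb{N}\}$, Fréchet spaces with the seminorms $\|\cdot\|_k$. Writing $a_{n,k}$ for the weights ($e^{k\alpha_n}$, resp. $e^{-\frac1k\beta_n}$), such a space is nuclear iff for every $k$ there is $l>k$ with $\sum_n a_{n,k}/a_{n,l}<\infty$. The dual of $\Lambda_\infty(\alpha)$ is identified with $(\Lambda_\infty(\alpha))'=\{y=(y_n)_{n\in\mathbb{N}}: \sup_n|y_n|e^{-k\alpha_n}<\infty\text{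 for some }k\in\mathbb{N}\}$. $e_n$ is the sequence with $1$ in the $n$-th place and $0$ elsewhere. A linear map $T:E\to F$ of Fréchet spaces is compact if $T(U)$ is precompact in $F$ for some neighborhood $U$ of zero in $E$. A one-sided sequence $(\eta_0,\eta_1,\eta_2,\dots)$ is regarded as an element of a sequence space indexed by $\mathbb{N}$ by letting its $n$-th coordinate be $\eta_{n-1}$. For such $\eta$ let $\hat T_\eta e_n=\sum_{j=n}^\infty \eta_{j-n}e_j$ and $\check T_\eta e_n=\sum_{j=1}^n\eta_{n-j}e_j$, extended to $x=\sum_n x_ne_n$ by $\hat T_\eta x=\sum_n x_n\hat T_\eta e_n$, $\check T_\eta x=\sum_n x_n\check T_\eta e_n$; well-defined means that the images of the $e_n$ lie in the target space and the series converge in the target space for every $x$ in the domain. Toeplitz operator: for $\theta=(\theta_j)_{j\in\mathbb{Z}}$ write $\theta_0=\theta_0'+\theta_0''$ with $\theta_0',\theta_0''$ both non-zero, and set $\hat\theta=(\theta_0',\theta_1,\theta_2,\dots)$, $\check\theta=(\theta_0'',\theta_{-1},\theta_{-2},\dots)$. Then $T_\theta:=\hat T_{\hat\theta}+\check T_{\check\theta}$, i.e. the operator whose matrix with respect to $(e_n)$ is the Toeplitz matrix with $(i,j)$ entry $\theta_{i-j}$. The notation $\theta\in\Lambda_1(\beta)\oplus(\Lambda_\infty(\alpha))'$ means $\hat\theta\in\Lambda_1(\beta)$ and $\check\theta\in(\Lambda_\infty(\alpha))'$. Standing assumption: each of the symbol sequences $\hat\theta$ and $\check\theta$ has infinitely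 many non-zero terms. *)

theory Defs
  imports "HOL-Analysis.Analysis"
begin

text \<open>
  Sequences indexed by \<open>{1,2,3,\<dots>}\<close> are functions on \<^typ>\<open>nat\<close>, where \<open>x i\<close> is the
  coordinate with number \<open>i + 1\<close>.  A symbol \<open>(\<eta>\<^sub>0, \<eta>\<^sub>1, \<dots>)\<close>, whose \<open>n\<close>-th coordinate
  is \<open>\<eta>\<^bsub>n-1\<^esub>\<close>, is then just the function \<open>\<eta>\<close>.  The indices \<open>k\<close> of the seminorms are not
  shifted: they range over \<open>k \<ge> 1\<close>.  The scalars are of a type of class
  \<open>{real_normed_field, euclidean_space}\<close>, which covers both \<^typ>\<open>real\<close> and \<^typ>\<open>complex\<close>.
\<close>

definition exponent_sequence :: "(nat \<Rightarrow> real) \<Rightarrow> bool" where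
  "exponent_sequence \<alpha> \<longleftrightarrow> (\<forall>n. 0 \<le> \<alpha> n) \<and> mono \<alpha> \<and> filterlim \<alpha> at_top sequentially"


subsection \<open>Power series spaces\<close>

text \<open>Weights \<open>a n k\<close> and the associated sequence space with its locally convex topology.\<close>

definition wnorm :: "(nat \<Rightarrow> nat \<Rightarrow> real) \<Rightarrow> nat \<Rightarrow> (nat \<Rightarrow> 'a::real_normed_field) \<Rightarrow> real" where
  "wnorm a k x = (\<Sum>n. norm (x n) * a n k)"

definition wspace :: "(nat \<Rightarrow> nat \<Rightarrow> real) \<Rightarrow> (nat \<Rightarrow> 'a::real_normed_field) set" where
  "wspace a = {x. \<forall>k\<ge>1. summable (\<lambda>n. norm (x n) * a n k)}"

definition wtop :: "(nat \<Rightarrow> nat \<Rightarrow> real) \<Rightarrow> (nat \<Rightarrow> 'a::real_normed_field) topology" where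
  "wtop a = topology_generated_by
     {{y \<in> wspace a. wnorm a k (\<lambda>n. y n - x n) < r} | k x r. 1 \<le> k \<and> x \<in> wspace a \<and> 0 < r}"

text \<open>Nuclearity of \<^term>\<open>wspace a\<close>, in the form of the Grothendieck--Pietsch criterion.\<close>

definition nuclear_weights :: "(nat \<Rightarrow> nat \<Rightarrow> real) \<Rightarrow> bool" where
  "nuclear_weights a \<longleftrightarrow> (\<forall>k\<ge>1. \<exists>l>k. summable (\<lambda>n. a n k / a n l))"

definition weight_inf :: "(nat \<Rightarrow> real) \<Rightarrow> nat \<Rightarrow> nat \<Rightarrow> real" where
  "weight_inf \<alpha> n k = exp (real k * \<alpha> n)"

definition weight_one :: "(nat \<Rightarrow> real) \<Rightarrow> nat \<Rightarrow> nat \<Rightarrow> real" where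
  "weight_one \<beta> n k = exp (- (1 / real k) * \<beta> n)"

abbreviation Lambda_inf :: "(nat \<Rightarrow> real) \<Rightarrow> (nat \<Rightarrow> 'a::real_normed_field) set" where
  "Lambda_inf \<alpha> \<equiv> wspace (weight_inf \<alpha>)"

abbreviation Lambda_one :: "(nat \<Rightarrow> real) \<Rightarrow> (nat \<Rightarrow> 'a::real_normed_field) set" where
  "Lambda_one \<beta> \<equiv> wspace (weight_one \<beta>)"

abbreviation Lambda_inf_top :: "(nat \<Rightarrow> real) \<Rightarrow> (nat \<Rightarrow> 'a::real_normed_field) topology" where
  "Lambda_inf_top \<alpha> \<equiv> wtop (weight_inf \<alpha>)"

abbreviation Lambda_one_top :: "(nat \<Rightarrow> real) \<Rightarrow> (nat \<Rightarrow> 'a::real_normed_field) topology" where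
  "Lambda_one_top \<beta> \<equiv> wtop (weight_one \<beta>)"

definition Lambda_inf_dual :: "(nat \<Rightarrow> real) \<Rightarrow> (nat \<Rightarrow> 'a::real_normed_field) set" where
  "Lambda_inf_dual \<alpha> = {y. \<exists>k\<ge>1. bdd_above (range (\<lambda>n. norm (y n) * exp (- real k * \<alpha> n)))}"

lemma topspace_wtop: "topspace (wtop a) = (wspace a :: (nat \<Rightarrow> 'a::real_normed_field) set)"
proof
  show "topspace (wtop a) \<subseteq> (wspace a :: (nat \<Rightarrow> 'a) set)"
    unfolding wtop_def topology_generated_by_topspace by (rule Union_least) force
  show "(wspace a :: (nat \<Rightarrow> 'a) set) \<subseteq> topspace (wtop a)"
  proof
    fix x :: "nat \<Rightarrow> 'a"
    assume x: "x \<in> wspace a"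
    show "x \<in> topspace (wtop a)"
      unfolding wtop_def topology_generated_by_topspace
    proof (rule UnionI)
      show "{y \<in> wspace a. wnorm a 1 (\<lambda>n. y n - x n) < 1}
          \<in> {{y \<in> wspace a. wnorm a k (\<lambda>n. y n - x n) < r} | k x r.
               1 \<le> k \<and> x \<in> wspace a \<and> 0 < r}"
        by (rule CollectI, rule exI[of _ 1], rule exI[of _ x], rule exI[of _ 1]) (simp add: x)
      show "x \<in> {y \<in> wspace a. wnorm a 1 (\<lambda>n. y n - x n) < 1}"
        using x by (simp add: wnorm_def)
    qed
  qed
qed


subsection \<open>Compact linear maps\<close>

text \<open>
  For a topology \<open>X\<close> on a space of scalar sequences, \<^term>\<open>topspace X\<close> is the space; vector
  operations are coordinatewise.
\<close>

definition linear_map_between ::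
  "(nat \<Rightarrow> 'a::real_normed_field) topology \<Rightarrow> (nat \<Rightarrow> 'a) topology \<Rightarrow>
    ((nat \<Rightarrow> 'a) \<Rightarrow> nat \<Rightarrow> 'a) \<Rightarrow> bool" where
  "linear_map_between X Y T \<longleftrightarrow>
     (\<forall>x\<in>topspace X. T x \<in> topspace Y) \<and>
     (\<forall>x\<in>topspace X. \<forall>y\<in>topspace X. T (\<lambda>n. x n + y n) = (\<lambda>n. T x n + T y n)) \<and>
     (\<forall>c. \<forall>x\<in>topspace X. T (\<lambda>n. c * x n) = (\<lambda>n. c * T x n))"

definition zero_nbhd :: "(nat \<Rightarrow> 'a::real_normed_field) topology \<Rightarrow> (nat \<Rightarrow> 'a) set \<Rightarrow> bool" where
  "zero_nbhd X U \<longleftrightarrow> U \<subseteq> topspace X \<and> (\<lambda>_. 0) \<in> X interior_of U"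

text \<open>Precompactness is total boundedness for the uniformity of the topological vector space.\<close>

definition precompact_in :: "(nat \<Rightarrow> 'a::real_normed_field) topology \<Rightarrow> (nat \<Rightarrow> 'a) set \<Rightarrow> bool" where
  "precompact_in X A \<longleftrightarrow> A \<subseteq> topspace X \<and>
     (\<forall>V. zero_nbhd X V \<longrightarrow>
        (\<exists>F. finite F \<and> F \<subseteq> topspace X \<and> A \<subseteq> (\<Union>f\<in>F. (\<lambda>v n. f n + v n) ` V)))"

definition compact_linear_map ::
  "(nat \<Rightarrow> 'a::real_normed_field) topology \<Rightarrow> (nat \<Rightarrow> 'a) topology \<Rightarrow>
    ((nat \<Rightarrow> 'a) \<Rightarrow> nat \<Rightarrow> 'a) \<Rightarrow> bool" where
  "compact_linear_map X Y T \<longleftrightarrow>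
     linear_map_between X Y T \<and> (\<exists>U. zero_nbhd X U \<and> precompact_in Y (T ` U))"


subsection \<open>Toeplitz operators\<close>

text \<open>
  \<open>c n\<close> is the image of the \<open>n\<close>-th unit vector.  The operator sends \<open>x\<close> to
  \<open>\<Sum>n. x n * c n\<close>, the series being taken in the topology of the target space.
\<close>

definition column_sums_to ::
  "(nat \<Rightarrow> 'a::real_normed_field) topology \<Rightarrow> (nat \<Rightarrow> nat \<Rightarrow> 'a) \<Rightarrow> (nat \<Rightarrow> 'a) \<Rightarrow>
    (nat \<Rightarrow> 'a) \<Rightarrow> bool" where
  "column_sums_to Y c x y \<longleftrightarrow> limitin Y (\<lambda>N i. \<Sum>n<N. x n * c n i) y sequentially"

definition column_op ::
  "(nat \<Rightarrow> 'a::real_normed_field) topology \<Rightarrow> (nat \<Rightarrow> nat \<Rightarrow> 'a) \<Rightarrow> (nat \<Rightarrow> 'a) \<Rightarrow> nat \<Rightarrow> 'a" where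
  "column_op Y c x = (THE y. column_sums_to Y c x y)"

definition column_op_well_defined ::
  "(nat \<Rightarrow> 'a::real_normed_field) topology \<Rightarrow> (nat \<Rightarrow> 'a) topology \<Rightarrow>
    (nat \<Rightarrow> nat \<Rightarrow> 'a) \<Rightarrow> bool" where
  "column_op_well_defined X Y c \<longleftrightarrow>
     (\<forall>n. c n \<in> topspace Y) \<and> (\<forall>x\<in>topspace X. \<exists>y. column_sums_to Y c x y)"

definition hat_columns :: "(nat \<Rightarrow> 'a::real_normed_field) \<Rightarrow> nat \<Rightarrow> nat \<Rightarrow> 'a" where
  "hat_columns \<eta> n = (\<lambda>j. if n \<le> j then \<eta> (j - n) else 0)"

definition check_columns :: "(nat \<Rightarrow> 'a::real_normed_field) \<Rightarrow> nat \<Rightarrow> nat \<Rightarrow> 'a" where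
  "check_columns \<eta> n = (\<lambda>j. if j \<le> n then \<eta> (n - j) else 0)"

text \<open>\<open>s\<close> and \<open>t\<close> are the two parts of the splitting \<open>\<theta> 0 = s + t\<close>.\<close>

definition hat_symbol :: "'a \<Rightarrow> (int \<Rightarrow> 'a) \<Rightarrow> nat \<Rightarrow> 'a::real_normed_field" where
  "hat_symbol s \<theta> = (\<lambda>n. if n = 0 then s else \<theta> (int n))"

definition check_symbol :: "'a \<Rightarrow> (int \<Rightarrow> 'a) \<Rightarrow> nat \<Rightarrow> 'a::real_normed_field" where
  "check_symbol t \<theta> = (\<lambda>n. if n = 0 then t else \<theta> (- int n))"

definition toeplitz_op ::
  "(nat \<Rightarrow> 'a::real_normed_field) topology \<Rightarrow> 'a \<Rightarrow> 'a \<Rightarrow> (int \<Rightarrow> 'a) \<Rightarrow>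
    (nat \<Rightarrow> 'a) \<Rightarrow> nat \<Rightarrow> 'a" where
  "toeplitz_op Y s t \<theta> x =
     (\<lambda>i. column_op Y (hat_columns (hat_symbol s \<theta>)) x i
        + column_op Y (check_columns (check_symbol t \<theta>)) x i)"

definition toeplitz_well_defined ::
  "(nat \<Rightarrow> 'a::real_normed_field) topology \<Rightarrow> (nat \<Rightarrow> 'a) topology \<Rightarrow>
    'a \<Rightarrow> 'a \<Rightarrow> (int \<Rightarrow> 'a) \<Rightarrow> bool" where
  "toeplitz_well_defined X Y s t \<theta> \<longleftrightarrow>
     column_op_well_defined X Y (hat_columns (hat_symbol s \<theta>)) \<and>
     column_op_well_defined X Y (check_columns (check_symbol t \<theta>))"

lemma toeplitz_matrix_entry:
  assumes "\<theta> 0 = s + t"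
  shows "hat_columns (hat_symbol s \<theta>) j i + check_columns (check_symbol t \<theta>) j i
    = \<theta> (int i - int j)"
proof (cases i j rule: linorder_cases)
  case less
  then show ?thesis
    by (simp add: hat_columns_def check_columns_def check_symbol_def of_nat_diff)
next
  case equal
  then show ?thesis
    using assms by (simp add: hat_columns_def check_columns_def hat_symbol_def check_symbol_def)
next
  case greater
  then show ?thesis
    by (simp add: hat_columns_def check_columns_def hat_symbol_def of_nat_diff)
qed

end

theory Submission
  imports Defs
begin

text \<open>
  Write \<open>a\<close> and \<open>b\<close> for the weights of the domain and the target.  Everything follows from one
  estimate on the columns of the Toeplitz matrix: there is a single index \<open>K\<close> such that for every
  \<open>k\<close> the \<open>n\<close>-th column of either half of the operator has \<open>k\<close>-th target norm at most
  \<open>D * a n K\<close>, with \<open>D\<close> depending on \<open>k\<close> only.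

  For the lower triangular half the columns are right shifts of the symbol
  in \<open>\<Lambda>\<^sub>1(\<beta>)\<close>, and a right shift does not increase a norm whose weights decrease along the sequence;
  so the columns are even bounded (lemma \<open>wnorm_hat_columns\<close>).  For the upper triangular half the
  coordinates of the \<open>n\<close>-th column are symbol entries with index at most \<open>n\<close>.  The symbol is in the
  dual of \<open>\<Lambda>\<^sub>\<infinity>(\<alpha>)\<close>, so these are bounded by a multiple of \<open>exp (K * \<alpha> n)\<close>, and nuclearity
  of \<open>\<Lambda>\<^sub>1(\<beta>)\<close> makes the weights themselves summable (lemma \<open>wnorm_check_columns\<close>).

  By completeness of the target the series defining \<open>T x\<close> then converges absolutely and
  \<open>wnorm b k (T x) \<le> D * wnorm a K x\<close> for every \<open>k\<close>.  This yields continuity.  Since \<open>K\<close> does not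
  depend on \<open>k\<close>, it also says that \<open>T\<close> maps the unit ball of the one seminorm \<open>wnorm a K\<close> to a set that
  is bounded in the target.  Bounded sets of a nuclear sequence space are precompact (lemma
  \<open>bounded_imp_precompact\<close>): the tails are uniformly small because the ratio of two weights tends
  to \<open>0\<close>, and the initial segments lie in a bounded set of a finite-dimensional space.
\<close>


section \<open>Seminorms of a weighted sequence space\<close>

locale koethe_weights =
  fixes a :: "nat \<Rightarrow> nat \<Rightarrow> real"
  assumes pos: "0 < a n k"
    and mono_k: "1 \<le> k \<Longrightarrow> k \<le> l \<Longrightarrow> a n k \<le> a n l"
begin

lemma nonneg_term: "0 \<le> norm (x n) * a n k"
  using pos[of n k] by simp

lemma summable_wspace: "x \<in> wspace a \<Longrightarrow> 1 \<le> k \<Longrightarrow> summable (\<lambda>n. norm (x n) * a n k)"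
  by (simp add: wspace_def)

lemma zero_in_wspace: "(\<lambda>_. 0) \<in> wspace a"
  by (simp add: wspace_def)

lemma wspace_add:
  assumes "x \<in> wspace a" "y \<in> wspace a"
  shows "(\<lambda>n. x n + y n) \<in> wspace a"
  unfolding wspace_def
proof (intro CollectI allI impI)
  fix k :: nat assume k: "1 \<le> k"
  show "summable (\<lambda>n. norm (x n + y n) * a n k)"
  proof (rule summable_comparison_test')
    show "summable (\<lambda>n. norm (x n) * a n k + norm (y n) * a n k)"
      using assms k by (intro summable_add summable_wspace)
    show "norm (norm (x n + y n) * a n k) \<le> norm (x n) * a n k + norm (y n) * a n k" if "0 \<le> n" for n
      using mult_right_mono[OF norm_triangle_ineq[of "x n" "y n"], of "a n k"] pos[of n k]
      by (simp add: distrib_right abs_mult)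
  qed
qed

lemma wspace_scale: "x \<in> wspace a \<Longrightarrow> (\<lambda>n. c * x n) \<in> wspace a"
  by (auto simp: wspace_def norm_mult mult.assoc intro: summable_mult)

lemma wspace_diff:
  assumes "x \<in> wspace a" "y \<in> wspace a"
  shows "(\<lambda>n. x n - y n) \<in> wspace a"
  using wspace_add[OF assms(1) wspace_scale[OF assms(2), of "-1"]] by simp

lemma wspace_sum: "(\<And>n. v n \<in> wspace a) \<Longrightarrow> (\<lambda>i. \<Sum>n<(N::nat). v n i) \<in> wspace a"
  by (induction N) (auto intro: zero_in_wspace wspace_add)

lemma wnorm_triangle:
  assumes "x \<in> wspace a" "y \<in> wspace a" "1 \<le> k"
  shows "wnorm a k (\<lambda>n. x n + y n) \<le> wnorm a k x + wnorm a k y"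
proof -
  have "wnorm a k (\<lambda>n. x n + y n) \<le> (\<Sum>n. norm (x n) * a n k + norm (y n) * a n k)"
    unfolding wnorm_def
  proof (rule suminf_le)
    show "norm (x n + y n) * a n k \<le> norm (x n) * a n k + norm (y n) * a n k" for n
      using mult_right_mono[OF norm_triangle_ineq[of "x n" "y n"], of "a n k"] pos[of n k]
      by (simp add: distrib_right)
    show "summable (\<lambda>n. norm (x n + y n) * a n k)"
      using wspace_add[OF assms(1,2)] assms(3) by (rule summable_wspace)
    show "summable (\<lambda>n. norm (x n) * a n k + norm (y n) * a n k)"
      using assms by (intro summable_add summable_wspace)
  qed
  also have "\<dots> = wnorm a k x + wnorm a k y"
    unfolding wnorm_def using assms by (intro suminf_add[symmetric] summable_wspace)
  finally show ?thesis .
qed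

lemma wnorm_mono_index:
  assumes "x \<in> wspace a" "1 \<le> k" "k \<le> l"
  shows "wnorm a k x \<le> wnorm a l x"
  unfolding wnorm_def
  using assms by (intro suminf_le mult_left_mono mono_k summable_wspace) auto

lemma wnorm_nonneg: "x \<in> wspace a \<Longrightarrow> 1 \<le> k \<Longrightarrow> 0 \<le> wnorm a k x"
  unfolding wnorm_def by (intro suminf_nonneg summable_wspace nonneg_term)

lemma coordinate_le_wnorm:
  assumes "x \<in> wspace a" "1 \<le> k"
  shows "norm (x i) * a i k \<le> wnorm a k x"
  unfolding wnorm_def
  using sum_le_suminf[OF summable_wspace[OF assms], of "{i}"] by (simp add: nonneg_term)

lemma wnorm_minus_commute: "wnorm a k (\<lambda>n. x n - y n) = wnorm a k (\<lambda>n. y n - x n)"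
  by (simp add: wnorm_def norm_minus_commute)

lemma wnorm_scale:
  assumes "x \<in> wspace a" "1 \<le> k"
  shows "wnorm a k (\<lambda>n. c * x n) = norm c * wnorm a k x"
  unfolding wnorm_def
  using suminf_mult[OF summable_wspace[OF assms], of "norm c"] by (simp add: norm_mult mult.assoc)


section \<open>The topology\<close>

definition wball :: "nat \<Rightarrow> (nat \<Rightarrow> 'a::real_normed_field) \<Rightarrow> real \<Rightarrow> (nat \<Rightarrow> 'a) set" where
  "wball k x r = {y \<in> wspace a. wnorm a k (\<lambda>n. y n - x n) < r}"

text \<open>
  The balls of all seminorms around all centres are a subbase by definition.  The triangle inequality
  recentres a ball at any of its points, and since the seminorms increase with \<open>k\<close>, two
  balls around one point both contain a third.  So the balls around a point are a neighbourhood base.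
\<close>

lemma openin_wtop_iff:
  fixes W :: "(nat \<Rightarrow> 'a::real_normed_field) set"
  shows "openin (wtop a) W \<longleftrightarrow>
    W \<subseteq> wspace a \<and> (\<forall>x\<in>W. \<exists>k\<ge>1. \<exists>r>0. wball k x r \<subseteq> W)"
    (is "_ \<longleftrightarrow> ?nbhd W")
proof
  let ?S = "{{y \<in> wspace a. wnorm a k (\<lambda>n. y n - x n) < r} | k (x::nat \<Rightarrow> 'a) r.
      1 \<le> k \<and> x \<in> wspace a \<and> 0 < r}"
  {
    assume "openin (wtop a) W"
    then have "generate_topology_on ?S W"
      by (simp add: wtop_def openin_topology_generated_by_iff)
    then show "?nbhd W"
    proof (induction rule: generate_topology_on.induct)
      case (Int U V)
      show ?case
      proof (intro conjI ballI)
        show "U \<inter> V \<subseteq> wspace a" using Int by blast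
        fix x assume x: "x \<in> U \<inter> V"
        from x Int.IH(1) obtain k r where k: "1 \<le> k" "0 < r" "wball k x r \<subseteq> U" by auto
        from x Int.IH(2) obtain l s where l: "1 \<le> l" "0 < s" "wball l x s \<subseteq> V" by auto
        have xs: "x \<in> wspace a" using x Int by blast
        have "wball (max k l) x (min r s) \<subseteq> wball k x r \<inter> wball l x s"
        proof
          fix y assume y: "y \<in> wball (max k l) x (min r s)"
          then have d: "(\<lambda>n. y n - x n) \<in> wspace a"
            using xs by (auto simp: wball_def intro: wspace_diff)
          show "y \<in> wball k x r \<inter> wball l x s"
            using y k(1) l(1) wnorm_mono_index[OF d, of k "max k l"]
              wnorm_mono_index[OF d, of l "max k l"]
            by (auto simp: wball_def)
        qed
        then show "\<exists>k\<ge>1. \<exists>r>0. wball k x r \<subseteq> U \<inter> V"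
          using k l by (intro exI[of _ "max k l"] conjI exI[of _ "min r s"]) auto
      qed
    next
      case (UN \<U>)
      show ?case
      proof (intro conjI ballI)
        show "\<Union>\<U> \<subseteq> wspace a" using UN by blast
        fix x assume "x \<in> \<Union>\<U>"
        then obtain U where U: "U \<in> \<U>" "x \<in> U" by blast
        with UN.IH[OF U(1)] obtain k r where "1 \<le> k" "0 < r" "wball k x r \<subseteq> U" by blast
        with U(1) show "\<exists>k\<ge>1. \<exists>r>0. wball k x r \<subseteq> \<Union>\<U>" by blast
      qed
    next
      case (Basis U)
      then obtain k x r where U: "U = wball k x r" "1 \<le> k" "x \<in> wspace a" "0 < r"
        by (auto simp: wball_def)
      show ?case
      proof (intro conjI ballI)
        show "U \<subseteq> wspace a" by (auto simp: U wball_def)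
        fix y assume y: "y \<in> U"
        then have ys: "y \<in> wspace a" and lt: "wnorm a k (\<lambda>n. y n - x n) < r"
          by (auto simp: U wball_def)
        have "wball k y (r - wnorm a k (\<lambda>n. y n - x n)) \<subseteq> U"
        proof
          fix z assume z: "z \<in> wball k y (r - wnorm a k (\<lambda>n. y n - x n))"
          then have zs: "z \<in> wspace a" by (simp add: wball_def)
          have "wnorm a k (\<lambda>n. z n - x n) \<le> wnorm a k (\<lambda>n. z n - y n) + wnorm a k (\<lambda>n. y n - x n)"
            using wnorm_triangle[OF wspace_diff[OF zs ys] wspace_diff[OF ys U(3)] U(2)] by simp
          with z show "z \<in> U" by (simp add: U(1) wball_def)
        qed
        with lt U(2) show "\<exists>k\<ge>1. \<exists>r>0. wball k y r \<subseteq> U"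
          by (intro exI[of _ k] conjI exI[of _ "r - wnorm a k (\<lambda>n. y n - x n)"]) auto
      qed
    qed auto
  }
  {
    assume W: "?nbhd W"
    have "\<exists>T. openin (wtop a) T \<and> x \<in> T \<and> T \<subseteq> W" if "x \<in> W" for x
    proof -
      from W that obtain k r where k: "1 \<le> k" "0 < r" "wball k x r \<subseteq> W" by auto
      have "wball k x r \<in> ?S" using k(1,2) W that by (auto simp: wball_def)
      then have "openin (wtop a) (wball k x r)"
        unfolding wtop_def by (rule topology_generated_by_Basis)
      moreover have "x \<in> wball k x r"
        using W that k(2) by (auto simp: wball_def wnorm_def)
      ultimately show ?thesis using k(3) by blast
    qed
    then show "openin (wtop a) W" by (subst openin_subopen) blast
  }
qed

lemma openin_wball:
  assumes "1 \<le> k" "x \<in> wspace a" "0 < r"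
  shows "openin (wtop a) (wball k x r)"
  unfolding wtop_def using assms
  by (intro topology_generated_by_Basis) (auto simp: wball_def)

lemma centre_in_wball: "x \<in> wspace a \<Longrightarrow> 0 < r \<Longrightarrow> x \<in> wball k x r"
  by (simp add: wball_def wnorm_def)

lemma zero_nbhd_wball:
  assumes "1 \<le> k" "0 < r"
  shows "zero_nbhd (wtop a) (wball k (\<lambda>_. 0) r)"
  unfolding zero_nbhd_def
  using interior_of_openin[OF openin_wball[OF assms(1) zero_in_wspace assms(2)]]
    centre_in_wball[OF zero_in_wspace assms(2)]
  by (auto simp: topspace_wtop wball_def)

lemma zero_nbhd_contains_wball:
  assumes "zero_nbhd (wtop a) V"
  obtains k r where "1 \<le> k" "0 < r" "wball k (\<lambda>_. 0) r \<subseteq> V"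
proof -
  have "(\<lambda>_. 0) \<in> wtop a interior_of V" using assms by (simp add: zero_nbhd_def)
  then have "\<exists>k\<ge>1. \<exists>r>0. wball k (\<lambda>_. 0) r \<subseteq> wtop a interior_of V"
    using bspec[OF conjunct2[OF openin_interior_of[of "wtop a" V, unfolded openin_wtop_iff]]] by simp
  then show ?thesis using that interior_of_subset[of "wtop a" V] by blast
qed

lemma limitin_wtopI:
  assumes f: "\<And>N. f N \<in> wspace a" and l: "l \<in> wspace a"
    and lim: "\<And>k. 1 \<le> k \<Longrightarrow> (\<lambda>N. wnorm a k (\<lambda>i. f N i - l i)) \<longlonglongrightarrow> 0"
  shows "limitin (wtop a) f l sequentially"
  unfolding limitin_def topspace_wtop
proof (intro conjI allI impI)
  fix U assume U: "openin (wtop a) U \<and> l \<in> U"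
  then obtain k r where k: "1 \<le> k" "0 < r" "wball k l r \<subseteq> U"
    using openin_wtop_iff by blast
  have "\<forall>\<^sub>F N in sequentially. wnorm a k (\<lambda>i. f N i - l i) < r"
    using order_tendstoD(2)[OF lim[OF k(1)] k(2)] .
  then show "\<forall>\<^sub>F N in sequentially. f N \<in> U"
    by eventually_elim (use k(3) f in \<open>auto simp: wball_def\<close>)
qed (fact l)

lemma limitin_wtop_coordinate:
  assumes "limitin (wtop a) f l sequentially"
  shows "(\<lambda>N. f N i) \<longlonglongrightarrow> l i"
proof (rule tendstoI)
  fix e :: real assume e: "0 < e"
  have l: "l \<in> wspace a" using assms by (simp add: limitin_def topspace_wtop)
  have r: "0 < e * a i 1" using e pos by simp
  have "\<forall>\<^sub>F N in sequentially. f N \<in> wball 1 l (e * a i 1)"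
    using assms openin_wball[OF order_refl l r] centre_in_wball[OF l r]
    by (auto simp: limitin_def)
  then show "\<forall>\<^sub>F N in sequentially. dist (f N i) (l i) < e"
  proof eventually_elim
    case (elim N)
    then have "norm (f N i - l i) * a i 1 < e * a i 1"
      using coordinate_le_wnorm[OF wspace_diff[OF _ l], of "f N" 1 i] by (auto simp: wball_def)
    then show ?case using pos[of i 1] by (simp add: dist_norm)
  qed
qed

lemma limitin_wtop_unique:
  assumes "limitin (wtop a) f y sequentially" "limitin (wtop a) f z sequentially"
  shows "y = z"
  by (rule ext) (rule LIMSEQ_unique[OF assms[THEN limitin_wtop_coordinate]])

lemma column_op_eqI:
  assumes "column_sums_to (wtop a) c x y"
  shows "column_op (wtop a) c x = y"
  unfolding column_op_def
proof (rule the_equality)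
  show "column_sums_to (wtop a) c x y" by (fact assms)
  show "z = y" if "column_sums_to (wtop a) c x z" for z
    using that assms unfolding column_sums_to_def by (rule limitin_wtop_unique)
qed


section \<open>Absolutely convergent series\<close>

text \<open>
  Completeness, in the form in which it is used: the coordinates of the terms
  are dominated by the norms, so the sum exists coordinatewise, and interchanging a finite
  sum over coordinates with the series bounds the norm of the sum.
\<close>

lemma
  fixes v :: "nat \<Rightarrow> nat \<Rightarrow> 'a::{real_normed_field, banach}"
  assumes v: "\<And>n. v n \<in> wspace a"
    and abs: "\<And>k. 1 \<le> k \<Longrightarrow> summable (\<lambda>n. wnorm a k (v n))"
  shows summable_coordinate: "summable (\<lambda>n. v n i)"
    and suminf_in_wspace: "(\<lambda>i. \<Sum>n. v n i) \<in> wspace a"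
    and wnorm_suminf_le: "1 \<le> k \<Longrightarrow> wnorm a k (\<lambda>i. \<Sum>n. v n i) \<le> (\<Sum>n. wnorm a k (v n))"
proof -
  have coord: "summable (\<lambda>n. norm (v n i) * a i k)" if k: "1 \<le> k" for i k
    using coordinate_le_wnorm[OF v k] pos[of i k]
    by (intro summable_comparison_test'[OF abs[OF k]]) (simp add: abs_mult)
  have norm_coord: "summable (\<lambda>n. norm (v n i))" for i
    using summable_divide[OF coord[of 1 i], of "a i 1"] pos[of i 1] by simp
  then show "summable (\<lambda>n. v n i)" by (rule summable_norm_cancel)
  have partial: "(\<Sum>i<I. norm (\<Sum>n. v n i) * a i k) \<le> (\<Sum>n. wnorm a k (v n))"
    if k: "1 \<le> k" for I k
  proof -
    have "(\<Sum>i<I. norm (\<Sum>n. v n i) * a i k) \<le> (\<Sum>i<I. (\<Sum>n. norm (v n i)) * a i k)"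
      using norm_coord by (intro sum_mono mult_right_mono summable_norm less_imp_le pos)
    also have "\<dots> = (\<Sum>i<I. \<Sum>n. norm (v n i) * a i k)"
      using norm_coord by (simp add: suminf_mult2)
    also have "\<dots> = (\<Sum>n. \<Sum>i<I. norm (v n i) * a i k)"
      using coord[OF k] by (intro suminf_sum[symmetric])
    also have "\<dots> \<le> (\<Sum>n. wnorm a k (v n))"
    proof (rule suminf_le)
      show "(\<Sum>i<I. norm (v n i) * a i k) \<le> wnorm a k (v n)" for n
        unfolding wnorm_def using nonneg_term
        by (intro sum_le_suminf summable_wspace v k) auto
    qed (use coord[OF k] abs[OF k] in \<open>auto intro: summable_sum\<close>)
    finally show ?thesis .
  qed
  have summ: "summable (\<lambda>i. norm (\<Sum>n. v n i) * a i k)" if "1 \<le> k" for k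
    using partial[OF that] by (intro summableI_nonneg_bounded nonneg_term)
  then show "(\<lambda>i. \<Sum>n. v n i) \<in> wspace a" by (simp add: wspace_def)
  show "wnorm a k (\<lambda>i. \<Sum>n. v n i) \<le> (\<Sum>n. wnorm a k (v n))" if "1 \<le> k"
    unfolding wnorm_def[of a k "\<lambda>i. \<Sum>n. v n i"]
    using suminf_le_const[OF summ[OF that] partial[OF that]] .
qed

lemma limitin_suminf:
  fixes v :: "nat \<Rightarrow> nat \<Rightarrow> 'a::{real_normed_field, banach}"
  assumes v: "\<And>n. v n \<in> wspace a"
    and abs: "\<And>k. 1 \<le> k \<Longrightarrow> summable (\<lambda>n. wnorm a k (v n))"
  shows "limitin (wtop a) (\<lambda>N i. \<Sum>n<N. v n i) (\<lambda>i. \<Sum>n. v n i) sequentially"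
proof (rule limitin_wtopI)
  show "(\<lambda>i. \<Sum>n<N. v n i) \<in> wspace a" for N using v by (rule wspace_sum)
  show S: "(\<lambda>i. \<Sum>n. v n i) \<in> wspace a" using v abs by (rule suminf_in_wspace)
  fix k :: nat assume k: "1 \<le> k"
  have tail: "wnorm a k (\<lambda>i. (\<Sum>n<N. v n i) - (\<Sum>n. v n i)) \<le> (\<Sum>n. wnorm a k (v (n + N)))" for N
  proof -
    have "(\<Sum>n. v n i) - (\<Sum>n<N. v n i) = (\<Sum>n. v (n + N) i)" for i
      using suminf_split_initial_segment[OF summable_coordinate[OF v abs], of i N] by simp
    then have "wnorm a k (\<lambda>i. (\<Sum>n<N. v n i) - (\<Sum>n. v n i)) = wnorm a k (\<lambda>i. \<Sum>n. v (n + N) i)"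
      by (subst wnorm_minus_commute) simp
    also have "\<dots> \<le> (\<Sum>n. wnorm a k (v (n + N)))"
      using v summable_ignore_initial_segment[OF abs] k by (rule wnorm_suminf_le)
    finally show ?thesis .
  qed
  show "(\<lambda>N. wnorm a k (\<lambda>i. (\<Sum>n<N. v n i) - (\<Sum>n. v n i))) \<longlonglongrightarrow> 0"
  proof (rule tendsto_sandwich[OF _ _ tendsto_const])
    show "(\<lambda>N. \<Sum>n. wnorm a k (v (n + N))) \<longlonglongrightarrow> 0"
      using abs[OF k] by (rule suminf_exist_split2)
    show "\<forall>\<^sub>F N in sequentially. 0 \<le> wnorm a k (\<lambda>i. (\<Sum>n<N. v n i) - (\<Sum>n. v n i))"
      using k by (intro always_eventually allI wnorm_nonneg wspace_diff S wspace_sum v)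
  qed (use tail in simp)
qed


section \<open>Bounded sets of a nuclear space are precompact\<close>

text \<open>
  A bounded set \<open>B\<close> is approximated by finitely many finitely supported sequences.
  Beyond a suitable \<open>N\<close> the weight \<open>a n k\<close> is at most a small multiple of \<open>a n l\<close>, so the bound on
  \<open>wnorm a l\<close> over \<open>B\<close> makes the tails small.  The first \<open>N\<close> coordinates range over balls of the
  scalar field and can be rounded to finite nets.
\<close>

lemma bounded_imp_precompact:
  fixes B :: "(nat \<Rightarrow> 'a::{real_normed_field, heine_borel}) set"
  assumes nuc: "nuclear_weights a"
    and B: "B \<subseteq> wspace a"
    and bdd: "\<And>k. 1 \<le> k \<Longrightarrow> \<exists>M. \<forall>y\<in>B. wnorm a k y \<le> M"
  shows "precompact_in (wtop a) B"
  unfolding precompact_in_def topspace_wtop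
proof (intro conjI allI impI B)
  fix V :: "(nat \<Rightarrow> 'a) set" assume "zero_nbhd (wtop a) V"
  then obtain k r where k: "1 \<le> k" and r: "0 < r" and V: "wball k (\<lambda>_. 0) r \<subseteq> V"
    by (rule zero_nbhd_contains_wball)
  obtain l where l: "k < l" and ratio: "summable (\<lambda>n. a n k / a n l)"
    using nuc k by (auto simp: nuclear_weights_def)
  have l1: "1 \<le> l" using k l by simp
  obtain M0 where M0: "\<And>y. y \<in> B \<Longrightarrow> wnorm a l y \<le> M0" using bdd[OF l1] by auto
  define M where "M = max M0 1"
  have M: "wnorm a l y \<le> M" if "y \<in> B" for y using M0[OF that] by (simp add: M_def)
  have Mpos: "0 < M" by (simp add: M_def)
  define \<epsilon> where "\<epsilon> = r / (4 * M)"
  have \<epsilon>: "0 < \<epsilon>" using r Mpos by (simp add: \<epsilon>_def)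
  from order_tendstoD(2)[OF summable_LIMSEQ_zero[OF ratio] \<epsilon>]
  obtain N where N: "\<And>n. N \<le> n \<Longrightarrow> a n k / a n l < \<epsilon>"
    by (auto simp: eventually_sequentially)
  have small: "a n k \<le> \<epsilon> * a n l" if "N \<le> n" for n
    using N[OF that] pos[of n l] by (simp add: divide_less_eq)
  \<comment> \<open>Chosen so that rounding each of the first \<open>N\<close> coordinates by \<open>\<delta>\<close> costs less than \<open>r / 2\<close>.\<close>
  define \<delta> where "\<delta> = r / (2 * (1 + (\<Sum>n<N. a n k)))"
  have S0: "0 \<le> (\<Sum>n<N. a n k)" using pos by (intro sum_nonneg less_imp_le)
  have \<delta>: "0 < \<delta>" using r S0 by (simp add: \<delta>_def)
  have "\<exists>G. finite G \<and> cball (0::'a) (M / a n l) \<subseteq> (\<Union>g\<in>G. ball g \<delta>)" for n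
  proof -
    have "compact (cball (0::'a) (M / a n l))" by (rule compact_cball)
    then show "\<exists>G. finite G \<and> cball (0::'a) (M / a n l) \<subseteq> (\<Union>g\<in>G. ball g \<delta>)"
      using \<delta> unfolding compact_eq_totally_bounded by blast
  qed
  then obtain G :: "nat \<Rightarrow> 'a set" where G: "\<And>n. finite (G n)"
    and cover: "\<And>n. cball 0 (M / a n l) \<subseteq> (\<Union>g\<in>G n. ball g \<delta>)"
    by metis
  define F where "F = {f. \<forall>n. (n \<in> {..<N} \<longrightarrow> f n \<in> (\<Union>n<N. G n)) \<and> (n \<notin> {..<N} \<longrightarrow> f n = (0::'a))}"
  have finF: "finite F"
    unfolding F_def using G by (intro finite_set_of_finite_funs) auto
  have Fsub: "F \<subseteq> wspace a"
  proof
    fix f assume "f \<in> F"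
    then have "f n = 0" if "n \<notin> {..<N}" for n using that by (auto simp: F_def)
    then show "f \<in> wspace a"
      unfolding wspace_def by (intro CollectI allI impI summable_finite[of "{..<N}"]) simp_all
  qed
  have "y \<in> (\<Union>f\<in>F. (\<lambda>v n. f n + v n) ` V)" if y: "y \<in> B" for y
  proof -
    have yw: "y \<in> wspace a" using B y by blast
    have "\<exists>g\<in>G n. dist g (y n) < \<delta>" for n
    proof -
      have "norm (y n) * a n l \<le> M"
        using coordinate_le_wnorm[OF yw l1, of n] M[OF y] by simp
      then have "y n \<in> cball 0 (M / a n l)" using pos[of n l] by (simp add: le_divide_eq)
      then have "y n \<in> (\<Union>g\<in>G n. ball g \<delta>)" using cover[of n] by blast
      then show ?thesis by simp
    qed
    then obtain g where g: "\<And>n. g n \<in> G n" "\<And>n. dist (g n) (y n) < \<delta>" by metis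
    define f where "f = (\<lambda>n. if n < N then g n else 0)"
    have f: "f \<in> F" using g(1) by (auto simp: F_def f_def)
    define z where "z = (\<lambda>n. y n - f n)"
    have z: "z \<in> wspace a" unfolding z_def using yw f Fsub by (blast intro: wspace_diff)
    have head: "(\<Sum>n<N. norm (z n) * a n k) \<le> r / 2"
    proof -
      have "(\<Sum>n<N. norm (z n) * a n k) \<le> (\<Sum>n<N. \<delta> * a n k)"
        using g(2) pos
        by (intro sum_mono mult_right_mono less_imp_le)
          (auto simp: z_def f_def dist_norm norm_minus_commute)
      also have "\<dots> = \<delta> * (\<Sum>n<N. a n k)" by (simp add: sum_distrib_left)
      also have "\<dots> \<le> \<delta> * (1 + (\<Sum>n<N. a n k))" using \<delta> by (intro mult_left_mono) auto
      also have "\<dots> = r / 2" using S0 by (simp add: \<delta>_def divide_simps)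
      finally show ?thesis .
    qed
    have tail: "(\<Sum>n. norm (z (n + N)) * a (n + N) k) \<le> r / 4"
    proof -
      have sy: "summable (\<lambda>n. norm (y (n + N)) * a (n + N) l)"
        using summable_ignore_initial_segment[OF summable_wspace[OF yw l1], of N] .
      have "(\<Sum>n. norm (z (n + N)) * a (n + N) k) \<le> (\<Sum>n. \<epsilon> * (norm (y (n + N)) * a (n + N) l))"
      proof (rule suminf_le)
        show "norm (z (n + N)) * a (n + N) k \<le> \<epsilon> * (norm (y (n + N)) * a (n + N) l)" for n
          using mult_left_mono[OF small[of "n + N"], of "norm (y (n + N))"]
          by (simp add: z_def f_def mult.left_commute)
        show "summable (\<lambda>n. norm (z (n + N)) * a (n + N) k)"
          using summable_ignore_initial_segment[OF summable_wspace[OF z k], of N] .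
        show "summable (\<lambda>n. \<epsilon> * (norm (y (n + N)) * a (n + N) l))"
          using sy by (rule summable_mult)
      qed
      also have "\<dots> = \<epsilon> * (\<Sum>n. norm (y (n + N)) * a (n + N) l)" using sy by (rule suminf_mult)
      also have "\<dots> \<le> \<epsilon> * wnorm a l y"
      proof -
        have "0 \<le> (\<Sum>n<N. norm (y n) * a n l)" by (intro sum_nonneg nonneg_term)
        then show ?thesis
          using \<epsilon> suminf_split_initial_segment[OF summable_wspace[OF yw l1], of N]
          by (intro mult_left_mono) (auto simp: wnorm_def)
      qed
      also have "\<dots> \<le> \<epsilon> * M" using M[OF y] \<epsilon> by (intro mult_left_mono) auto
      also have "\<dots> = r / 4" using Mpos by (simp add: \<epsilon>_def)
      finally show ?thesis .
    qed
    have "wnorm a k z < r"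
      unfolding wnorm_def
      using suminf_split_initial_segment[OF summable_wspace[OF z k], of N] head tail r by simp
    then have "z \<in> V" using z V by (auto simp: wball_def)
    moreover have "y = (\<lambda>n. f n + z n)" by (simp add: z_def)
    ultimately show ?thesis using f by blast
  qed
  then show "\<exists>F. finite F \<and> F \<subseteq> wspace a \<and> B \<subseteq> (\<Union>f\<in>F. (\<lambda>v n. f n + v n) ` V)"
    using finF Fsub by blast
qed

end


section \<open>Maps bounded on a ball of one seminorm\<close>

lemma linear_map_between_add:
  "linear_map_between X Y T \<Longrightarrow> x \<in> topspace X \<Longrightarrow> y \<in> topspace X \<Longrightarrow>
    T (\<lambda>n. x n + y n) = (\<lambda>n. T x n + T y n)"
  by (simp add: linear_map_between_def)

lemma linear_map_between_scale:
  "linear_map_between X Y T \<Longrightarrow> x \<in> topspace X \<Longrightarrow> T (\<lambda>n. c * x n) = (\<lambda>n. c * T x n)"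
  by (simp add: linear_map_between_def)

text \<open>
  The index \<open>K\<close> on the domain side is the same for all seminorms of the target.  Continuity alone
  would let it depend on \<open>k\<close>; the uniform choice is what gives compactness.
\<close>

definition ball_bounded ::
  "(nat \<Rightarrow> nat \<Rightarrow> real) \<Rightarrow> (nat \<Rightarrow> nat \<Rightarrow> real) \<Rightarrow> nat \<Rightarrow>
    ((nat \<Rightarrow> 'a::real_normed_field) \<Rightarrow> nat \<Rightarrow> 'a) \<Rightarrow> bool" where
  "ball_bounded a b K T \<longleftrightarrow> linear_map_between (wtop a) (wtop b) T \<and>
     (\<forall>k\<ge>1. \<exists>D. \<forall>x\<in>wspace a. wnorm b k (T x) \<le> D * wnorm a K x)"

lemma ball_bounded_add:
  fixes S T :: "(nat \<Rightarrow> 'a::real_normed_field) \<Rightarrow> nat \<Rightarrow> 'a"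
  assumes "koethe_weights b" "ball_bounded a b K S" "ball_bounded a b K T"
  shows "ball_bounded a b K (\<lambda>x i. S x i + T x i)"
proof -
  interpret B: koethe_weights b by fact
  have S: "S x \<in> wspace b" and T: "T x \<in> wspace b" if "x \<in> wspace a" for x
    using assms that by (auto simp: ball_bounded_def linear_map_between_def topspace_wtop)
  have lin: "linear_map_between (wtop a) (wtop b) S" "linear_map_between (wtop a) (wtop b) T"
    using assms by (simp_all add: ball_bounded_def)
  have "\<exists>D. \<forall>x\<in>wspace a. wnorm b k (\<lambda>i. S x i + T x i) \<le> D * wnorm a K x" if k: "1 \<le> k" for k
  proof -
    obtain D E where D: "\<And>x. x \<in> wspace a \<Longrightarrow> wnorm b k (S x) \<le> D * wnorm a K x"
      and E: "\<And>x. x \<in> wspace a \<Longrightarrow> wnorm b k (T x) \<le> E * wnorm a K x"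
      using assms k unfolding ball_bounded_def by meson
    have "wnorm b k (\<lambda>i. S x i + T x i) \<le> (D + E) * wnorm a K x" if "x \<in> wspace a" for x
      using B.wnorm_triangle[OF S T k, OF that that] D[OF that] E[OF that]
      by (simp add: distrib_right)
    then show ?thesis by blast
  qed
  moreover have "linear_map_between (wtop a) (wtop b) (\<lambda>x i. S x i + T x i)"
    unfolding linear_map_between_def topspace_wtop
  proof (intro conjI ballI allI)
    fix x :: "nat \<Rightarrow> 'a" assume x: "x \<in> wspace a"
    show "(\<lambda>i. S x i + T x i) \<in> wspace b" using S[OF x] T[OF x] by (rule B.wspace_add)
    show "(\<lambda>i. S (\<lambda>n. x n + y n) i + T (\<lambda>n. x n + y n) i)
        = (\<lambda>n. (S x n + T x n) + (S y n + T y n))" if y: "y \<in> wspace a" for y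
      using lin[THEN linear_map_between_add] x y by (simp add: topspace_wtop add_ac)
    show "(\<lambda>i. S (\<lambda>n. c * x n) i + T (\<lambda>n. c * x n) i) = (\<lambda>n. c * (S x n + T x n))" for c
      using lin[THEN linear_map_between_scale] x by (simp add: topspace_wtop distrib_left)
  qed
  ultimately show ?thesis by (simp add: ball_bounded_def)
qed

lemma ball_bounded_continuous:
  fixes T :: "(nat \<Rightarrow> 'a::real_normed_field) \<Rightarrow> nat \<Rightarrow> 'a"
  assumes "koethe_weights a" "koethe_weights b" and K: "1 \<le> K" and T: "ball_bounded a b K T"
  shows "continuous_map (wtop a) (wtop b) T"
proof -
  interpret A: koethe_weights a by fact
  interpret B: koethe_weights b by fact
  have Tw: "T x \<in> wspace b" if "x \<in> wspace a" for x
    using T that by (auto simp: ball_bounded_def linear_map_between_def topspace_wtop)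
  have Tdiff: "T (\<lambda>i. y i - x i) = (\<lambda>i. T y i - T x i)" if "x \<in> wspace a" "y \<in> wspace a" for x y
  proof -
    have lin: "linear_map_between (wtop a) (wtop b) T" using T by (simp add: ball_bounded_def)
    show ?thesis
      using linear_map_between_add[OF lin, of y "\<lambda>i. (- 1) * x i"]
        linear_map_between_scale[OF lin, of x "-1"] A.wspace_scale[OF that(1), of "-1"] that
      by (simp add: topspace_wtop)
  qed
  have "openin (wtop a) {x \<in> wspace a. T x \<in> U}" if U: "openin (wtop b) U" for U
    unfolding A.openin_wtop_iff
  proof (intro conjI ballI)
    fix x assume "x \<in> {x \<in> wspace a. T x \<in> U}"
    then have x: "x \<in> wspace a" and TU: "T x \<in> U" by auto
    from U TU obtain k r where k: "1 \<le> k" and r: "0 < r" and sub: "B.wball k (T x) r \<subseteq> U"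
      unfolding B.openin_wtop_iff by blast
    obtain D0 where D0: "\<And>x. x \<in> wspace a \<Longrightarrow> wnorm b k (T x) \<le> D0 * wnorm a K x"
      using T k unfolding ball_bounded_def by meson
    define D where "D = max D0 1"
    have Dpos: "0 < D" by (simp add: D_def)
    have "A.wball K x (r / D) \<subseteq> {x \<in> wspace a. T x \<in> U}"
    proof
      fix y assume "y \<in> A.wball K x (r / D)"
      then have y: "y \<in> wspace a" and lt: "wnorm a K (\<lambda>i. y i - x i) < r / D"
        by (auto simp: A.wball_def)
      note d = A.wspace_diff[OF y x]
      have "wnorm b k (\<lambda>i. T y i - T x i) \<le> D0 * wnorm a K (\<lambda>i. y i - x i)"
        using D0[OF d] by (simp add: Tdiff[OF x y])
      also have "\<dots> \<le> D * wnorm a K (\<lambda>i. y i - x i)"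
        using A.wnorm_nonneg[OF d K] by (intro mult_right_mono) (auto simp: D_def)
      also have "\<dots> < r" using lt Dpos by (simp add: less_divide_eq mult.commute)
      finally show "y \<in> {x \<in> wspace a. T x \<in> U}" using sub y Tw[OF y] by (auto simp: B.wball_def)
    qed
    then show "\<exists>k\<ge>1. \<exists>r>0. A.wball k x r \<subseteq> {x \<in> wspace a. T x \<in> U}"
      using K r Dpos by (intro exI[of _ K] conjI exI[of _ "r / D"]) auto
  qed auto
  then show ?thesis
    using Tw by (auto simp: continuous_map_def topspace_wtop)
qed

lemma ball_bounded_compact:
  fixes T :: "(nat \<Rightarrow> 'a::{real_normed_field, heine_borel}) \<Rightarrow> nat \<Rightarrow> 'a"
  assumes "koethe_weights a" "koethe_weights b" and nuc: "nuclear_weights b"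
    and K: "1 \<le> K" and T: "ball_bounded a b K T"
  shows "compact_linear_map (wtop a) (wtop b) T"
proof -
  interpret A: koethe_weights a by fact
  interpret B: koethe_weights b by fact
  let ?U = "A.wball K (\<lambda>_. 0) 1 :: (nat \<Rightarrow> 'a) set"
  have "precompact_in (wtop b) (T ` ?U)"
  proof (rule B.bounded_imp_precompact[OF nuc])
    show "T ` ?U \<subseteq> wspace b"
      using T by (auto simp: A.wball_def ball_bounded_def linear_map_between_def topspace_wtop)
    fix k :: nat assume "1 \<le> k"
    then obtain D where D: "\<And>x. x \<in> wspace a \<Longrightarrow> wnorm b k (T x) \<le> D * wnorm a K x"
      using T unfolding ball_bounded_def by meson
    have "wnorm b k (T x) \<le> \<bar>D\<bar>" if "x \<in> ?U" for x
    proof -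
      from that have x: "x \<in> wspace a" and lt: "wnorm a K x < 1" by (auto simp: A.wball_def)
      have "wnorm b k (T x) \<le> D * wnorm a K x" using D[OF x] .
      also have "\<dots> \<le> \<bar>D\<bar> * wnorm a K x"
        using A.wnorm_nonneg[OF x K] by (intro mult_right_mono) auto
      also have "\<dots> \<le> \<bar>D\<bar> * 1" using lt by (intro mult_left_mono) auto
      finally show ?thesis by simp
    qed
    then show "\<exists>M. \<forall>y\<in>T ` ?U. wnorm b k y \<le> M" by blast
  qed
  then show ?thesis
    using A.zero_nbhd_wball[OF K, of 1] T
    by (auto simp: compact_linear_map_def ball_bounded_def)
qed


section \<open>Operators given by their columns\<close>

text \<open>
  The bound on the columns makes the \<open>k\<close>-th norms of the terms of \<open>\<Sum>n. x n * c n\<close> at most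
  \<open>D * norm (x n) * a n K\<close>, whose sum over \<open>n\<close> is \<open>D * wnorm a K x\<close>.
\<close>

lemma
  fixes c :: "nat \<Rightarrow> nat \<Rightarrow> 'a::{real_normed_field, banach}"
  assumes "koethe_weights a" "koethe_weights b" and K: "1 \<le> K"
    and c: "\<And>n. c n \<in> wspace b"
    and bound: "\<And>k. 1 \<le> k \<Longrightarrow> \<exists>D. \<forall>n. wnorm b k (c n) \<le> D * a n K"
  shows column_op_well_defined_if_bounded: "column_op_well_defined (wtop a) (wtop b) c"
    and ball_bounded_column_op: "ball_bounded a b K (column_op (wtop b) c)"
proof -
  interpret A: koethe_weights a by fact
  interpret B: koethe_weights b by fact
  have v: "(\<lambda>i. x n * c n i) \<in> wspace b" for x n using c by (rule B.wspace_scale)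
  have wv: "wnorm b k (\<lambda>i. x n * c n i) = norm (x n) * wnorm b k (c n)" if "1 \<le> k" for x n k
    using c that by (rule B.wnorm_scale)
  have vle: "wnorm b k (\<lambda>i. x n * c n i) \<le> D * (norm (x n) * a n K)"
    if "\<forall>n. wnorm b k (c n) \<le> D * a n K" "1 \<le> k" for D k x n
    using mult_left_mono[OF that(1)[rule_format, of n] norm_ge_zero[of "x n"]] wv[OF that(2)]
    by (simp add: mult.left_commute)
  have abs: "summable (\<lambda>n. wnorm b k (\<lambda>i. x n * c n i))" if x: "x \<in> wspace a" and k: "1 \<le> k" for x k
  proof -
    obtain D where D: "\<forall>n. wnorm b k (c n) \<le> D * a n K" using bound[OF k] by blast
    show ?thesis
      using vle[OF D k] B.wnorm_nonneg[OF v k]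
      by (intro summable_comparison_test'[OF summable_mult[OF A.summable_wspace[OF x K]]])
        (simp add: abs_of_nonneg)
  qed
  have sums: "column_sums_to (wtop b) c x (\<lambda>i. \<Sum>n. x n * c n i)" if x: "x \<in> wspace a" for x
    unfolding column_sums_to_def using v abs[OF x] by (rule B.limitin_suminf)
  then show "column_op_well_defined (wtop a) (wtop b) c"
    using c by (auto simp: column_op_well_defined_def topspace_wtop)
  have op: "column_op (wtop b) c x = (\<lambda>i. \<Sum>n. x n * c n i)" if "x \<in> wspace a" for x
    using sums[OF that] by (rule B.column_op_eqI)
  have coord: "summable (\<lambda>n. x n * c n i)" if "x \<in> wspace a" for x i
    using v abs[OF that] by (rule B.summable_coordinate)
  have "linear_map_between (wtop a) (wtop b) (column_op (wtop b) c)"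
    unfolding linear_map_between_def topspace_wtop
  proof (intro conjI ballI allI)
    fix x :: "nat \<Rightarrow> 'a" assume x: "x \<in> wspace a"
    show "column_op (wtop b) c x \<in> wspace b"
      unfolding op[OF x] using v abs[OF x] by (rule B.suminf_in_wspace)
    show "column_op (wtop b) c (\<lambda>n. s * x n) = (\<lambda>n. s * column_op (wtop b) c x n)" for s
      using coord[OF x] by (simp add: op x A.wspace_scale mult.assoc suminf_mult)
    show "column_op (wtop b) c (\<lambda>n. x n + y n)
        = (\<lambda>n. column_op (wtop b) c x n + column_op (wtop b) c y n)" if y: "y \<in> wspace a" for y
      using coord[OF x] coord[OF y]
      by (simp add: op x y A.wspace_add distrib_right suminf_add)
  qed
  moreover have "\<exists>D. \<forall>x\<in>wspace a. wnorm b k (column_op (wtop b) c x) \<le> D * wnorm a K x"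
    if k: "1 \<le> k" for k
  proof -
    obtain D where D: "\<forall>n. wnorm b k (c n) \<le> D * a n K" using bound[OF k] by blast
    have "wnorm b k (column_op (wtop b) c x) \<le> D * wnorm a K x" if x: "x \<in> wspace a" for x
    proof -
      have "wnorm b k (column_op (wtop b) c x) \<le> (\<Sum>n. wnorm b k (\<lambda>i. x n * c n i))"
        unfolding op[OF x] using v abs[OF x] k by (rule B.wnorm_suminf_le)
      also have "\<dots> \<le> (\<Sum>n. D * (norm (x n) * a n K))"
        using vle[OF D k] abs[OF x k] A.summable_wspace[OF x K]
        by (intro suminf_le summable_mult)
      also have "\<dots> = D * wnorm a K x"
        unfolding wnorm_def using A.summable_wspace[OF x K] by (rule suminf_mult)
      finally show ?thesis .
    qed
    then show ?thesis by blast
  qed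
  ultimately show "ball_bounded a b K (column_op (wtop b) c)" by (simp add: ball_bounded_def)
qed


section \<open>Columns of Toeplitz matrices\<close>

lemma koethe_weights_inf:
  assumes "exponent_sequence \<alpha>"
  shows "koethe_weights (weight_inf \<alpha>)"
  using assms by unfold_locales (auto simp: weight_inf_def exponent_sequence_def intro!: mult_right_mono)

lemma koethe_weights_one:
  assumes "exponent_sequence \<beta>"
  shows "koethe_weights (weight_one \<beta>)"
proof
  fix n k l :: nat
  show "0 < weight_one \<beta> n k" by (simp add: weight_one_def)
  assume "1 \<le> k" "k \<le> l"
  then have "1 / real l * \<beta> n \<le> 1 / real k * \<beta> n"
    using assms by (intro mult_right_mono divide_left_mono) (auto simp: exponent_sequence_def)
  then show "weight_one \<beta> n k \<le> weight_one \<beta> n l" by (simp add: weight_one_def)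
qed

lemma weight_one_antimono:
  assumes "exponent_sequence \<beta>" "i \<le> j"
  shows "weight_one \<beta> j k \<le> weight_one \<beta> i k"
proof -
  have "\<beta> i \<le> \<beta> j" using assms by (auto simp: exponent_sequence_def mono_def)
  then show ?thesis by (simp add: weight_one_def divide_right_mono)
qed

text \<open>
  The exponents are non-negative, so every weight is at most \<open>1\<close>, and the ratios that nuclearity
  makes summable dominate the weights in their numerators.
\<close>

lemma summable_weight_one:
  assumes \<beta>: "exponent_sequence \<beta>" and nuc: "nuclear_weights (weight_one \<beta>)" and k: "1 \<le> k"
  shows "summable (\<lambda>n. weight_one \<beta> n k)"
proof -
  obtain l where ratio: "summable (\<lambda>n. weight_one \<beta> n k / weight_one \<beta> n l)"
    using nuc k unfolding nuclear_weights_def by blast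
  show ?thesis
  proof (rule summable_comparison_test'[OF ratio])
    fix n :: nat
    have "0 \<le> \<beta> n" using \<beta> by (simp add: exponent_sequence_def)
    then have "weight_one \<beta> n l \<le> 1" and "0 < weight_one \<beta> n l" and "0 < weight_one \<beta> n k"
      by (auto simp: weight_one_def)
    then show "norm (weight_one \<beta> n k) \<le> weight_one \<beta> n k / weight_one \<beta> n l"
      by (simp add: le_divide_eq mult_left_le)
  qed
qed

text \<open>
  The columns are right shifts of the symbol.  Since \<open>\<beta>\<close> increases, each entry meets a
  smaller weight after the shift.
\<close>

lemma
  assumes \<beta>: "exponent_sequence \<beta>" and \<eta>: "\<eta> \<in> Lambda_one \<beta>"
  shows hat_columns_in_Lambda_one: "hat_columns \<eta> n \<in> Lambda_one \<beta>"
    and wnorm_hat_columns: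
      "1 \<le> k \<Longrightarrow> wnorm (weight_one \<beta>) k (hat_columns \<eta> n) \<le> wnorm (weight_one \<beta>) k \<eta>"
proof -
  interpret B: koethe_weights "weight_one \<beta>" using \<beta> by (rule koethe_weights_one)
  let ?f = "\<lambda>k j. norm (hat_columns \<eta> n j) * weight_one \<beta> j k"
  have le: "?f k (i + n) \<le> norm (\<eta> i) * weight_one \<beta> i k" for i k
    using weight_one_antimono[OF \<beta>, of i "i + n"] by (simp add: hat_columns_def mult_left_mono)
  have shifted: "summable (\<lambda>i. ?f k (i + n))" if k: "1 \<le> k" for k
    using le
    by (intro summable_comparison_test'[OF B.summable_wspace[OF \<eta> k]])
      (simp add: abs_mult abs_of_pos[OF B.pos])
  then have summ: "summable (?f k)" if "1 \<le> k" for k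
    using that summable_iff_shift[of "?f k" n] by simp
  then show "hat_columns \<eta> n \<in> Lambda_one \<beta>" by (simp add: wspace_def)
  show "wnorm (weight_one \<beta>) k (hat_columns \<eta> n) \<le> wnorm (weight_one \<beta>) k \<eta>" if k: "1 \<le> k"
  proof -
    have "wnorm (weight_one \<beta>) k (hat_columns \<eta> n) = (\<Sum>i. ?f k (i + n))"
      using suminf_split_initial_segment[OF summ[OF k], of n]
      by (simp add: wnorm_def hat_columns_def)
    also have "\<dots> \<le> wnorm (weight_one \<beta>) k \<eta>"
      unfolding wnorm_def using le shifted[OF k] B.summable_wspace[OF \<eta> k] by (rule suminf_le)
    finally show ?thesis .
  qed
qed

text \<open>
  The constant \<open>M\<close> and the index \<open>K\<close> witness that the symbol is in the dual.  As \<open>\<alpha>\<close>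
  increases, \<open>M * exp (K * \<alpha> n)\<close> bounds all the symbol entries with index at most \<open>n\<close>, hence the whole
  \<open>n\<close>-th column, and the remaining factor is the sum of the weights.
\<close>

lemma
  assumes \<alpha>: "exponent_sequence \<alpha>" and \<beta>: "exponent_sequence \<beta>"
    and nuc: "nuclear_weights (weight_one \<beta>)"
    and M: "\<And>m. norm (\<eta> m) * exp (- real K * \<alpha> m) \<le> M"
  shows check_columns_in_Lambda_one: "check_columns \<eta> n \<in> Lambda_one \<beta>"
    and wnorm_check_columns: "1 \<le> k \<Longrightarrow> wnorm (weight_one \<beta>) k (check_columns \<eta> n)
      \<le> M * (\<Sum>j. weight_one \<beta> j k) * weight_inf \<alpha> n K"
proof -
  interpret B: koethe_weights "weight_one \<beta>" using \<beta> by (rule koethe_weights_one)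
  have "0 \<le> norm (\<eta> 0) * exp (- real K * \<alpha> 0)" by simp
  then have M0: "0 \<le> M" using M[of 0] by linarith
  have coord: "norm (check_columns \<eta> n j) \<le> M * weight_inf \<alpha> n K" for j
  proof (cases "j \<le> n")
    case True
    have "norm (\<eta> (n - j)) \<le> M * exp (real K * \<alpha> (n - j))"
      using M[of "n - j"] by (simp add: exp_minus divide_inverse[symmetric] divide_le_eq)
    also have "\<dots> \<le> M * exp (real K * \<alpha> n)"
      using M0 \<alpha> by (auto simp: exponent_sequence_def mono_def intro!: mult_left_mono)
    finally show ?thesis using True by (simp add: check_columns_def weight_inf_def)
  next
    case False
    then show ?thesis using M0 by (simp add: check_columns_def weight_inf_def)
  qed
  have le: "norm (check_columns \<eta> n j) * weight_one \<beta> j k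
      \<le> M * weight_inf \<alpha> n K * weight_one \<beta> j k" for j k
    using coord B.pos[of j k] by (intro mult_right_mono) auto
  have summ: "summable (\<lambda>j. norm (check_columns \<eta> n j) * weight_one \<beta> j k)" if "1 \<le> k" for k
    using le
    by (intro summable_comparison_test'[OF summable_mult[OF summable_weight_one[OF \<beta> nuc that]]])
      (simp add: abs_mult abs_of_pos[OF B.pos])
  then show "check_columns \<eta> n \<in> Lambda_one \<beta>" by (simp add: wspace_def)
  show "wnorm (weight_one \<beta>) k (check_columns \<eta> n)
      \<le> M * (\<Sum>j. weight_one \<beta> j k) * weight_inf \<alpha> n K" if k: "1 \<le> k"
  proof -
    note sk = summable_weight_one[OF \<beta> nuc k]
    have "wnorm (weight_one \<beta>) k (check_columns \<eta> n)
        \<le> (\<Sum>j. M * weight_inf \<alpha> n K * weight_one \<beta> j k)"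
      unfolding wnorm_def using le summ[OF k] summable_mult[OF sk] by (rule suminf_le)
    also have "\<dots> = M * weight_inf \<alpha> n K * (\<Sum>j. weight_one \<beta> j k)" using sk by (rule suminf_mult)
    finally show ?thesis by (simp add: mult_ac)
  qed
qed


section \<open>Compactness of Toeplitz operators\<close>

theorem theorem5p5:
  fixes \<alpha> \<beta> :: "nat \<Rightarrow> real"
    and \<theta> :: "int \<Rightarrow> 'a::{real_normed_field, euclidean_space}"
    and s t :: 'a
  assumes "exponent_sequence \<alpha>" and "exponent_sequence \<beta>"
    and "nuclear_weights (weight_inf \<alpha>)" and "nuclear_weights (weight_one \<beta>)"
    and "\<theta> 0 = s + t" and "s \<noteq> 0" and "t \<noteq> 0"
    and "infinite {n. hat_symbol s \<theta> n \<noteq> 0}" and "infinite {n. check_symbol t \<theta> n \<noteq> 0}"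
    and "hat_symbol s \<theta> \<in> Lambda_one \<beta>" and "check_symbol t \<theta> \<in> Lambda_inf_dual \<alpha>"
  shows "toeplitz_well_defined (Lambda_inf_top \<alpha>) (Lambda_one_top \<beta>) s t \<theta>
    \<and> continuous_map (Lambda_inf_top \<alpha>) (Lambda_one_top \<beta>)
        (toeplitz_op (Lambda_one_top \<beta>) s t \<theta>)
    \<and> compact_linear_map (Lambda_inf_top \<alpha>) (Lambda_one_top \<beta>)
        (toeplitz_op (Lambda_one_top \<beta>) s t \<theta>)"
proof -
  note \<alpha> = \<open>exponent_sequence \<alpha>\<close> and \<beta> = \<open>exponent_sequence \<beta>\<close>
    and nuc = \<open>nuclear_weights (weight_one \<beta>)\<close> and hat = \<open>hat_symbol s \<theta> \<in> Lambda_one \<beta>\<close>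
  note kw = koethe_weights_inf[OF \<alpha>] koethe_weights_one[OF \<beta>]
  interpret B: koethe_weights "weight_one \<beta>" by (rule kw)
  obtain K M where K: "1 \<le> K"
    and M: "\<And>m. norm (check_symbol t \<theta> m) * exp (- real K * \<alpha> m) \<le> M"
    using \<open>check_symbol t \<theta> \<in> Lambda_inf_dual \<alpha>\<close> by (auto simp: Lambda_inf_dual_def bdd_above_def)
  \<comment> \<open>The columns of the lower triangular half are bounded, and the weights \<open>exp (K * \<alpha> n)\<close> are at
    least \<open>1\<close>, so the index \<open>K\<close> of the upper triangular half serves for both.\<close>
  have hat_bound: "\<exists>D. \<forall>n. wnorm (weight_one \<beta>) k (hat_columns (hat_symbol s \<theta>) n) \<le> D * weight_inf \<alpha> n K"
    if k: "1 \<le> k" for k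
  proof (intro exI allI)
    fix n
    have "1 \<le> weight_inf \<alpha> n K" using \<alpha> by (simp add: weight_inf_def exponent_sequence_def)
    with B.wnorm_nonneg[OF hat k] have "wnorm (weight_one \<beta>) k (hat_symbol s \<theta>)
        \<le> wnorm (weight_one \<beta>) k (hat_symbol s \<theta>) * weight_inf \<alpha> n K"
      using mult_left_mono by fastforce
    with wnorm_hat_columns[OF \<beta> hat k, of n]
    show "wnorm (weight_one \<beta>) k (hat_columns (hat_symbol s \<theta>) n)
        \<le> wnorm (weight_one \<beta>) k (hat_symbol s \<theta>) * weight_inf \<alpha> n K"
      by linarith
  qed
  have check_bound: "\<exists>D. \<forall>n. wnorm (weight_one \<beta>) k (check_columns (check_symbol t \<theta>) n)
      \<le> D * weight_inf \<alpha> n K" if "1 \<le> k" for k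
    using wnorm_check_columns[OF \<alpha> \<beta> nuc M that] by blast
  note hat_op = kw K hat_columns_in_Lambda_one[OF \<beta> hat] hat_bound
  note check_op = kw K check_columns_in_Lambda_one[OF \<alpha> \<beta> nuc M] check_bound
  have "toeplitz_well_defined (Lambda_inf_top \<alpha>) (Lambda_one_top \<beta>) s t \<theta>"
    unfolding toeplitz_well_defined_def
    using column_op_well_defined_if_bounded[OF hat_op] column_op_well_defined_if_bounded[OF check_op]
    by blast
  moreover have "ball_bounded (weight_inf \<alpha>) (weight_one \<beta>) K (toeplitz_op (Lambda_one_top \<beta>) s t \<theta>)"
    using ball_bounded_add[OF kw(2) ball_bounded_column_op[OF hat_op] ball_bounded_column_op[OF check_op]]
    by (simp add: toeplitz_op_def[abs_def])
  ultimately show ?thesis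
    using ball_bounded_continuous[OF kw K] ball_bounded_compact[OF kw nuc K] by blast
qed

end
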